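(* Let $C$ be a nonempty, convex, bounded subset of $\mathbb{R}^n$, and let $P_1, \dots, P_k$ ($k\ge 1$) be planks in $\mathbb{R}^n$, with directions $v_1, \dots, v_k$ and widths $w_1, \dots, w_k$ respectively, which cover $C$, i.e. $C\subseteq\bigcup_{i=1}^k P_i$. Let $V$ be the linear span of the directions $v_1,\dots,v_k$, and let $\pi_V(C)$ be the image of $C$ under the orthogonal projection $\pi_V:\mathbb{R}^n\to V$. Then $$ \sum_{i=1}^k \frac{w_i}{w_{v_i}(C)} \geq \frac{1}{\dim \pi_V(C)}. $$
   Context: A plank $P$ in $\mathbb{R}^n$ is the closed, connected region between two parallel hyperplanes, i.e. a set $\{x : a \le \langle u,x\rangle \le b\}$ with $u$ a unit vector and $a\le b$ real. Its width is the distance $b-a$ between the two hyperplanes, and its direction is the one-dimensional linear subspace $v=\mathbb{R}u$ of $\mathbb{R}^n$ perpendicular to them. For a one-dimensional linear subspace $v=\mathbb{R}u$ ($|u|=1$) and a bounded convex set $K$, $w_v(K)$ denotes the width of the smallest plank of direction $v$ which covers $K$; for nonempty $K$ this equals $\sup_{x\in K}\langle u,x\rangle-\inf_{x\in K}\langle u,x\rangle$. Convention: if $w_{v_i}(C)=0$, the ratio $\frac{w_i}{w_{v_i}(C)}$ is defined to be $+\infty$. The dimension of a convex set $K\subseteq\mathbb{R}^n$ is the dimension of the unique affine subspace of $\mathbb{R}^n$ containing $K$ in which $K$ has non-empty interior (its affine hull). If $\dim\pi_V(C)=0$, the right-hand side is read as $+\infty$ (in that case every $w_{v_i}(C)$ is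 $0$). *)

theory Defs
  imports "HOL-Analysis.Analysis"
begin

text \<open>\<open>plank v w P\<close>: the set \<open>P\<close> is a plank of direction \<open>v\<close> (a line through the origin) and
  width \<open>w\<close>. Both are determined by \<open>P\<close>, see \<open>plank_unique\<close> below. The case
  \<open>w = 0\<close> (a hyperplane) is allowed.\<close>

definition plank :: "'a::euclidean_space set \<Rightarrow> real \<Rightarrow> 'a set \<Rightarrow> bool" where
  "plank v w P \<longleftrightarrow>
     (\<exists>u a b. norm u = 1 \<and> a \<le> b \<and> v = span {u} \<and> w = b - a \<and> P = {x. a \<le> u \<bullet> x \<and> u \<bullet> x \<le> b})"

text \<open>For nonempty bounded \<open>K\<close> and a line \<open>v\<close> the infimum is attained, so this is the width of
  the smallest plank of direction \<open>v\<close> covering \<open>K\<close>; see \<open>width_in_smallest\<close> and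
  \<open>width_in_eq\<close> below.\<close>

definition width_in :: "'a::euclidean_space set \<Rightarrow> 'a set \<Rightarrow> real" where
  "width_in v K = Inf {w. \<exists>P. plank v w P \<and> K \<subseteq> P}"

definition orth_proj :: "'a::euclidean_space set \<Rightarrow> 'a \<Rightarrow> 'a" where
  "orth_proj V x = (THE y. y \<in> V \<and> (\<forall>z\<in>V. orthogonal (x - y) z))"

text \<open>Quotient with the convention that division by zero, including \<open>0 / 0\<close>, gives
  \<open>\<infinity>\<close>; the library's \<open>0 / 0\<close> on \<open>ereal\<close> is \<open>0\<close>.\<close>

definition ratio :: "real \<Rightarrow> real \<Rightarrow> ereal" where
  "ratio x y = (if y = 0 then \<infinity> else ereal (x / y))"

lemma orth_proj:
  assumes "subspace V"
  shows "orth_proj V x \<in> V" and "z \<in> V \<Longrightarrow> orthogonal (x - orth_proj V x) z"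
proof -
  obtain y d where yd: "y \<in> span V" "\<And>z. z \<in> span V \<Longrightarrow> orthogonal d z" "x = y + d"
    using orthogonal_subspace_decomp_exists[of V x] by blast
  have "span V = V" using assms by (simp only: span_eq_iff)
  with yd have y: "y \<in> V \<and> (\<forall>z\<in>V. orthogonal (x - y) z)"
    by simp
  have uniq: "y' = y" if y': "y' \<in> V \<and> (\<forall>z\<in>V. orthogonal (x - y') z)" for y'
  proof -
    have "y' - y \<in> V" using y' y subspace_diff[OF assms] by blast
    then have "(x - y) \<bullet> (y' - y) = 0" "(x - y') \<bullet> (y' - y) = 0"
      using y' y unfolding orthogonal_def by blast+
    then have "(y' - y) \<bullet> (y' - y) = 0"
      by (simp add: inner_diff_left)
    then show ?thesis by simp
  qed
  have "orth_proj V x = y"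
    unfolding orth_proj_def by (rule the_equality) (fact y, rule uniq)
  with y show "orth_proj V x \<in> V" and "z \<in> V \<Longrightarrow> orthogonal (x - orth_proj V x) z"
    by blast+
qed

lemma span_unit_eq:
  fixes u u' :: "'a::euclidean_space"
  assumes "norm u = 1" "norm u' = 1" "span {u} = span {u'}"
  shows "u' = u \<or> u' = - u"
proof -
  have "u' \<in> span {u}" using assms(3) by (simp add: span_base)
  then obtain c where "u' = c *\<^sub>R u" by (auto simp: span_singleton)
  with assms(1,2) have "\<bar>c\<bar> = 1" by simp
  then have "c = 1 \<or> c = -1" by linarith
  then show ?thesis using \<open>u' = c *\<^sub>R u\<close> by auto
qed

lemma plank_unique:
  assumes "plank v w P" "plank v' w' P"
  shows "v = v'" "w = w'"
proof -
  obtain u a b where 1: "norm u = 1" "a \<le> b" "v = span {u}" "w = b - a"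
    "P = {x. a \<le> u \<bullet> x \<and> u \<bullet> x \<le> b}"
    using assms(1) unfolding plank_def by blast
  obtain u' a' b' where 2: "norm u' = 1" "a' \<le> b'" "v' = span {u'}" "w' = b' - a'"
    "P = {x. a' \<le> u' \<bullet> x \<and> u' \<bullet> x \<le> b'}"
    using assms(2) unfolding plank_def by blast
  have uu: "u \<bullet> u = 1" "u' \<bullet> u' = 1" using 1(1) 2(1) by (simp_all add: dot_square_norm)
  define d where "d = u' - (u \<bullet> u') *\<^sub>R u"
  have du: "u \<bullet> d = 0" by (simp add: d_def inner_diff_right uu)
  have dd: "u' \<bullet> d = d \<bullet> d"
    using du by (simp add: d_def inner_diff_left inner_diff_right inner_commute uu)
  have "d = 0"
  proof (rule ccontr)
    assume "d \<noteq> 0"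
    then have pos: "d \<bullet> d > 0" by simp
    define t where "t = (b' - a * (u' \<bullet> u) + 1) / (d \<bullet> d)"
    have "a *\<^sub>R u + t *\<^sub>R d \<in> P" using 1(2,5) du uu by (simp add: inner_add_right)
    then have "a * (u' \<bullet> u) + t * (d \<bullet> d) \<le> b'" using 2(5) dd by (simp add: inner_add_right)
    then show False using pos by (simp add: t_def)
  qed
  then have u': "u' = (u \<bullet> u') *\<^sub>R u" by (simp add: d_def)
  have "norm u' = \<bar>u \<bullet> u'\<bar> * norm u"
    using arg_cong[OF u', of norm] by (simp only: norm_scaleR)
  then have "u \<bullet> u' = 1 \<or> u \<bullet> u' = - 1" using 1(1) 2(1) by auto
  then have "u' = u \<or> u' = - u"
    using u' by (metis scaleR_minus1_left scaleR_one)
  moreover have *: "a \<le> t \<and> t \<le> b \<longleftrightarrow> a' \<le> t * (u' \<bullet> u) \<and> t * (u' \<bullet> u) \<le> b'" for t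
  proof -
    have "t *\<^sub>R u \<in> P \<longleftrightarrow> a \<le> t \<and> t \<le> b" using 1(5) uu by simp
    moreover have "t *\<^sub>R u \<in> P \<longleftrightarrow> a' \<le> t * (u' \<bullet> u) \<and> t * (u' \<bullet> u) \<le> b'" using 2(5) by simp
    ultimately show ?thesis by simp
  qed
  ultimately have "v = v' \<and> w = w'"
  proof (elim disjE)
    assume "u' = u"
    moreover from this have "a = a'" "b = b'"
      using *[of a] *[of b] *[of a'] *[of b'] 1(2) 2(2) uu by auto
    ultimately show ?thesis using 1(3,4) 2(3,4) by simp
  next
    assume m: "u' = - u"
    moreover from this have "a = - b'" "b = - a'"
      using *[of a] *[of b] *[of "-a'"] *[of "-b'"] 1(2) 2(2) uu by auto
    moreover have "span {- u} = span {u}"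
    proof -
      have "- u \<in> span {u}" "u \<in> span {- u}"
        using span_neg[of u "{u}"] span_neg[of "-u" "{-u}"] by (auto simp: span_base)
      then show ?thesis by (simp add: span_eq)
    qed
    ultimately show ?thesis using 1(3,4) 2(3,4) by simp
  qed
  then show "v = v'" "w = w'" by auto
qed

lemma width_in_aux:
  fixes u :: "'a::euclidean_space"
  assumes u: "norm u = 1" and K: "bounded K" "K \<noteq> {}"
  defines "d \<equiv> (SUP x\<in>K. u \<bullet> x) - (INF x\<in>K. u \<bullet> x)"
  shows "\<exists>P. plank (span {u}) d P \<and> K \<subseteq> P"
    and "plank (span {u}) w P \<Longrightarrow> K \<subseteq> P \<Longrightarrow> d \<le> w"
proof -
  have "bounded ((\<bullet>) u ` K)"
    using K(1) by (rule bounded_linear_image) (rule bounded_linear_inner_right)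
  then have bdd: "bdd_above ((\<bullet>) u ` K)" "bdd_below ((\<bullet>) u ` K)"
    by (auto intro: bounded_imp_bdd_above bounded_imp_bdd_below)
  let ?P = "{x. (INF x\<in>K. u \<bullet> x) \<le> u \<bullet> x \<and> u \<bullet> x \<le> (SUP x\<in>K. u \<bullet> x)}"
  have KP: "K \<subseteq> ?P" using bdd by (auto intro: cINF_lower cSUP_upper)
  then have "(INF x\<in>K. u \<bullet> x) \<le> (SUP x\<in>K. u \<bullet> x)" using K(2) by fastforce
  then have "plank (span {u}) d ?P" unfolding plank_def d_def using u by blast
  then show "\<exists>P. plank (span {u}) d P \<and> K \<subseteq> P" using KP by blast
  show "d \<le> w" if P: "plank (span {u}) w P" "K \<subseteq> P"
  proof -
    obtain u' a b where 1: "norm u' = 1" "span {u} = span {u'}" "w = b - a"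
      "P = {x. a \<le> u' \<bullet> x \<and> u' \<bullet> x \<le> b}"
      using P(1) unfolding plank_def by blast
    from span_unit_eq[OF u 1(1,2)] show ?thesis
    proof
      assume "u' = u"
      then have "(SUP x\<in>K. u \<bullet> x) \<le> b" "a \<le> (INF x\<in>K. u \<bullet> x)"
        using 1(4) P(2) K(2) by (auto intro!: cSUP_least cINF_greatest)
      then show ?thesis by (simp add: d_def 1(3))
    next
      assume "u' = - u"
      then have "(SUP x\<in>K. u \<bullet> x) \<le> - a" "- b \<le> (INF x\<in>K. u \<bullet> x)"
        using 1(4) P(2) K(2) by (force intro!: cSUP_least cINF_greatest)+
      then show ?thesis by (simp add: d_def 1(3))
    qed
  qed
qed

lemma width_in_eq:
  assumes "norm u = 1" "bounded K" "K \<noteq> {}"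
  shows "width_in (span {u}) K = (SUP x\<in>K. u \<bullet> x) - (INF x\<in>K. u \<bullet> x)"
  unfolding width_in_def using width_in_aux[OF assms] by (intro cInf_eq_minimum) auto

lemma width_in_smallest:
  assumes "norm u = 1" "bounded K" "K \<noteq> {}"
  shows "\<exists>P. plank (span {u}) (width_in (span {u}) K) P \<and> K \<subseteq> P"
    and "plank (span {u}) w P \<Longrightarrow> K \<subseteq> P \<Longrightarrow> width_in (span {u}) K \<le> w"
  using width_in_aux[OF assms] by (simp_all add: width_in_eq[OF assms])

end

theory Submission
  imports Defs
begin

text \<open>
  For a Euclidean ball of radius \<open>1\<close> Bang's theorem bounds the total width of a covering by
  planks from below by \<open>2\<close>, the width of the ball. A bounded convex set whose affine hull
  has dimension \<open>d\<close> is, by John's theorem, affinely a set between a ball and the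
  concentric ball of radius \<open>d\<close>. The quotient of the width of a plank by the width of the set
  in the same direction is an affine invariant, so the two facts combine: the planks cover the inner
  ball, and replacing its width by that of the set costs at most the factor \<open>d\<close>. Hence the
  sum of the quotients is at least \<open>1 / d\<close> (\<open>plank_sum_compact\<close>).

  Bang's theorem (\<open>plank_theorem_unit_ball\<close>) rests on a choice of signs: among all sums
  \<open>\<Sum> \<plusminus> t\<^sub>i u\<^sub>i\<close> of the scaled normals, one that maximises a quadratic
  expression has distance at least \<open>t\<^sub>i\<close> from every central hyperplane
  (\<open>Bang_sign_choice\<close>).

  John's theorem (\<open>John_ellipsoid\<close>) takes an inscribed ellipsoid of largest volume and
  transforms it to the unit ball. If the set contained a point \<open>t e\<close> with
  \<open>norm e = 1\<close> and \<open>t > d\<close>, then the convex hull of the ball and that point would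
  contain an ellipsoid of larger volume, elongated and moved a little towards the point
  (\<open>stretched_ball_in_hull_of_ball_and_point\<close>, \<open>volume_gain\<close>).

  The planks do not see the component of a point orthogonal to the span of their directions. The
  argument is therefore applied to the projection of the set to that span, which is covered by the
  same planks and has the same widths; closures change neither property.
\<close>

section \<open>Maps of prescribed determinant\<close>

text \<open>An orthogonal map that takes a coordinate axis to \<open>e\<close> conjugates a diagonal
  matrix to the wanted one.\<close>

lemma line_stretch_exists:
  fixes e :: "real ^ 'n"
  assumes "norm e = 1"
  obtains S where "\<And>x. S *v x = x + ((t - 1) * (e \<bullet> x)) *\<^sub>R e" and "det S = t"
proof -
  fix k :: 'n
  obtain U where U: "orthogonal_matrix U" and Uk: "U *v axis k 1 = e"
    using orthogonal_matrix_exists_basis[OF assms] by metis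
  define D :: "real ^ 'n ^ 'n" where "D = (\<chi> i j. if i = j then (if i = k then t else 1) else 0)"
  have D: "D *v y = y + ((t - 1) * (y $ k)) *\<^sub>R axis k 1" for y
  proof -
    have "(D *v y) $ i = (if i = k then t else 1) * y $ i" for i
      by (simp add: D_def matrix_vector_mult_def if_distrib [where f = "\<lambda>a. a * _"] cong: if_cong)
    then show ?thesis by (simp add: vec_eq_iff axis_def algebra_simps)
  qed
  have detD: "det D = t"
  proof -
    have "det D = (\<Prod>i\<in>UNIV. D $ i $ i)" by (rule det_diagonal) (simp add: D_def)
    also have "\<dots> = (\<Prod>i\<in>UNIV. if i = k then t else 1)" by (simp add: D_def)
    finally show ?thesis by simp
  qed
  have UU: "U ** transpose U = mat 1" using U by (simp add: orthogonal_matrix_def)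
  have comp: "(transpose U *v x) $ k = e \<bullet> x" for x
  proof -
    have "(transpose U *v x) $ k = axis k 1 \<bullet> (transpose U *v x)"
      by (simp add: inner_axis')
    also have "\<dots> = (U *v axis k 1) \<bullet> x"
      by (metis dot_lmul_matrix inner_commute transpose_matrix_vector transpose_transpose)
    finally show ?thesis by (simp add: Uk)
  qed
  show ?thesis
  proof
    show "(U ** D ** transpose U) *v x = x + ((t - 1) * (e \<bullet> x)) *\<^sub>R e" for x
    proof -
      have "(U ** D ** transpose U) *v x = U *v (D *v (transpose U *v x))"
        by (simp only: matrix_vector_mul_assoc matrix_mul_assoc)
      also have "\<dots> = (U ** transpose U) *v x + ((t - 1) * (e \<bullet> x)) *\<^sub>R (U *v axis k 1)"
        unfolding D comp
        by (simp only: matrix_vector_right_distrib matrix_vector_mul_assoc matrix_vector_mult_scaleR)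
      finally show ?thesis by (simp only: UU Uk matrix_vector_mul_lid)
    qed
    have "det U * det (transpose U) = 1"
      using UU by (metis det_I det_mul)
    then show "det (U ** D ** transpose U) = t"
      by (simp add: det_mul detD mult.assoc mult.left_commute)
  qed
qed

text \<open>The dilation is the product of the stretches by \<open>r\<close> along the vectors of an
  orthonormal basis of \<open>W\<close>, which reduces its determinant to that of a single stretch.\<close>

lemma subspace_dilation_exists:
  fixes W :: "(real ^ 'n) set"
  assumes "subspace W"
  obtains S where "\<And>x. x \<in> W \<Longrightarrow> S *v x = r *\<^sub>R x"
    and "\<And>x. (\<forall>z\<in>W. orthogonal x z) \<Longrightarrow> S *v x = x"
    and "det S = r ^ dim W"
proof -
  have ind: "\<exists>S :: real^'n^'n. (\<forall>x\<in>span B. S *v x = r *\<^sub>R x) \<and>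
      (\<forall>x. (\<forall>b\<in>B. orthogonal x b) \<longrightarrow> S *v x = x) \<and> det S = r ^ card B"
    if "finite B" "pairwise orthogonal B" "\<forall>b\<in>B. norm b = 1" for B
    using that
  proof (induction B rule: finite_induct)
    case empty
    show ?case by (rule exI[of _ "mat 1"]) simp
  next
    case (insert b B)
    then obtain S :: "real^'n^'n" where S: "\<forall>x\<in>span B. S *v x = r *\<^sub>R x"
      "\<forall>x. (\<forall>b\<in>B. orthogonal x b) \<longrightarrow> S *v x = x" "det S = r ^ card B"
      by (auto simp: pairwise_insert)
    obtain L where L: "\<And>x. L *v x = x + ((r - 1) * (b \<bullet> x)) *\<^sub>R b" "det L = r"
      using line_stretch_exists[of b r] insert.prems by auto
    have bB: "\<forall>c\<in>B. orthogonal b c"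
      using insert by (auto simp: pairwise_insert orthogonal_commute)
    have Sb: "S *v b = b" using S(2) bB by blast
    have Lb: "L *v b = r *\<^sub>R b"
      using L(1)[of b] insert.prems by (simp add: dot_square_norm algebra_simps)
    show ?case
    proof (intro exI conjI ballI allI impI)
      fix x assume "x \<in> span (insert b B)"
      then obtain c where "x - c *\<^sub>R b \<in> span B" using span_breakdown_eq by blast
      then obtain y where y: "y \<in> span B" "x = c *\<^sub>R b + y" by (metis add.commute diff_add_cancel)
      have "orthogonal b y" using bB y(1) by (simp add: orthogonal_to_span)
      then have "L *v y = y" using L(1) by (simp add: orthogonal_def)
      then have "(S ** L) *v x = S *v (c *\<^sub>R (r *\<^sub>R b) + y)"
        by (simp add: y(2) Lb matrix_vector_right_distrib matrix_vector_mult_scaleR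
            flip: matrix_vector_mul_assoc)
      also have "\<dots> = r *\<^sub>R x"
        using S(1) y by (simp add: Sb matrix_vector_right_distrib matrix_vector_mult_scaleR algebra_simps)
      finally show "(S ** L) *v x = r *\<^sub>R x" .
    next
      fix x assume x: "\<forall>c\<in>insert b B. orthogonal x c"
      then have "L *v x = x" using L(1) by (simp add: orthogonal_def inner_commute)
      then show "(S ** L) *v x = x" using S(2) x by (simp flip: matrix_vector_mul_assoc)
    next
      show "det (S ** L) = r ^ card (insert b B)" using S(3) L(2) insert.hyps by (simp add: det_mul)
    qed
  qed
  obtain B where B: "B \<subseteq> W" "pairwise orthogonal B" "\<And>x. x \<in> B \<Longrightarrow> norm x = 1"
    "independent B" "card B = dim W" "span B = W"
    using orthonormal_basis_subspace[OF assms] by metis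
  have "finite B" using B(4) by (rule independent_imp_finite)
  from ind[OF this B(2)] B(3) obtain S :: "real^'n^'n" where S: "\<forall>x\<in>span B. S *v x = r *\<^sub>R x"
    "\<forall>x. (\<forall>b\<in>B. orthogonal x b) \<longrightarrow> S *v x = x" "det S = r ^ card B" by auto
  show ?thesis
  proof
    show "S *v x = r *\<^sub>R x" if "x \<in> W" for x using that S(1) B(6) by simp
    show "S *v x = x" if "\<forall>z\<in>W. orthogonal x z" for x using that S(2) B(1) by blast
    show "det S = r ^ dim W" using S(3) B(5) by simp
  qed
qed

section \<open>John's ellipsoid\<close>

text \<open>As \<open>x\<close> runs over the unit ball, \<open>z\<close> runs over the ellipsoid with centre
  \<open>s e\<close>, semi-axis \<open>1 + s\<close> along \<open>e\<close> and semi-axes \<open>\<alpha>\<close> orthogonal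
  to \<open>e\<close>. This ellipsoid touches the unit ball in \<open>- e\<close>, and the value of
  \<open>\<alpha>\<close> is the one for which it is also inscribed in the cone with apex \<open>t e\<close>
  tangent to the unit ball. The conclusion says that \<open>z\<close> is a convex combination of
  \<open>t e\<close>, with weight \<open>l\<close>, and a point of the unit ball.\<close>

lemma stretched_ball_in_hull_of_ball_and_point:
  fixes e x :: "'a::real_inner"
  assumes e: "norm e = 1" and x: "norm x \<le> 1" and t: "t > 1" and s: "s \<ge> 0" "2 * s < t - 1"
    and \<alpha>: "\<alpha>\<^sup>2 = 1 - 2 * s / (t - 1)"
  defines "z \<equiv> s *\<^sub>R e + \<alpha> *\<^sub>R x + ((1 + s - \<alpha>) * (e \<bullet> x)) *\<^sub>R e"
  obtains l where "0 \<le> l" "l < 1" "norm (z - (l * t) *\<^sub>R e) \<le> 1 - l"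
proof -
  define a where "a = e \<bullet> x"
  define q where "q = 1 + s"
  define z1 where "z1 = s + q * a"
  have ee: "e \<bullet> e = 1" using e by (simp add: dot_square_norm)
  have "\<bar>a\<bar> \<le> 1" using Cauchy_Schwarz_ineq2[of e x] e x by (simp add: a_def)
  then have a: "-1 \<le> a" "a \<le> 1" by auto
  have xx: "x \<bullet> x \<le> 1" using x by (simp add: dot_square_norm power_le_one)
  \<comment> \<open>Only the coordinate along \<open>e\<close> and the distance from the axis matter, so the problem
    is planar.\<close>
  have dist: "norm (z - (l * t) *\<^sub>R e) ^ 2 \<le> (z1 - l * t)\<^sup>2 + \<alpha>\<^sup>2 * (1 - a\<^sup>2)" for l
  proof -
    have "z - (l * t) *\<^sub>R e = (z1 - l * t) *\<^sub>R e + \<alpha> *\<^sub>R (x - a *\<^sub>R e)"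
      by (simp add: z_def z1_def q_def a_def algebra_simps)
    moreover have "((p *\<^sub>R e + \<alpha> *\<^sub>R y) \<bullet> (p *\<^sub>R e + \<alpha> *\<^sub>R y)) = p\<^sup>2 + \<alpha>\<^sup>2 * (y \<bullet> y)"
      if "e \<bullet> y = 0" for p y
      using that by (simp add: inner_add_left inner_add_right ee inner_commute power2_eq_square)
    moreover have "e \<bullet> (x - a *\<^sub>R e) = 0" by (simp add: inner_diff_right ee a_def)
    moreover have "(x - a *\<^sub>R e) \<bullet> (x - a *\<^sub>R e) = x \<bullet> x - a\<^sup>2"
      by (simp add: inner_diff_right inner_diff_left ee a_def inner_commute power2_eq_square)
    ultimately have "norm (z - (l * t) *\<^sub>R e) ^ 2 = (z1 - l * t)\<^sup>2 + \<alpha>\<^sup>2 * (x \<bullet> x - a\<^sup>2)"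
      by (simp add: power2_norm_eq_inner)
    then show ?thesis using xx by (simp add: mult_left_mono)
  qed
  have \<alpha>t: "\<alpha>\<^sup>2 * (t - 1) = t - 1 - 2 * s" using \<alpha> t by (simp add: field_simps)
  have q: "q > 0" using s by (simp add: q_def)
  show ?thesis
  proof (cases "t * z1 \<le> 1")
    case True
    have z1_le: "z1 \<le> 1"
    proof (rule ccontr)
      assume "\<not> z1 \<le> 1"
      then have "1 * 1 < t * z1" using t by (intro mult_strict_mono) auto
      then show False using True by simp
    qed
    \<comment> \<open>On the near side of the cone's circle of tangency \<open>l = 0\<close> works: \<open>z\<close> lies
      in the ball itself. Both sides of the inequality below are the quotients by \<open>1 + a\<close> of
      the terms to be compared, because the two bodies touch at \<open>a = -1\<close>.\<close>
    have key: "\<alpha>\<^sup>2 * (1 - a) \<le> q * (1 - z1)"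
    proof -
      have "2 * s * (1 + 2 * s - t * z1) \<ge> 0" and "(t - 1) * s\<^sup>2 * (1 - z1) \<ge> 0"
        using True s t z1_le by auto
      moreover have "(t - 1) * (q * (1 - z1)) * q - (t - 1 - 2 * s) * (1 - a) * q
          = 2 * s * (1 + 2 * s - t * z1) + (t - 1) * s\<^sup>2 * (1 - z1)"
        by (simp add: z1_def q_def power2_eq_square algebra_simps)
      ultimately have "(t - 1 - 2 * s) * (1 - a) * q \<le> (t - 1) * (q * (1 - z1)) * q" by linarith
      then have "(t - 1 - 2 * s) * (1 - a) \<le> (t - 1) * (q * (1 - z1))"
        using q by (rule mult_right_le_imp_le)
      then have "(t - 1) * (\<alpha>\<^sup>2 * (1 - a)) \<le> (t - 1) * (q * (1 - z1))"
        unfolding \<alpha>t[symmetric] by (simp add: algebra_simps)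
      then show ?thesis using t by simp
    qed
    have "z1\<^sup>2 + \<alpha>\<^sup>2 * (1 - a\<^sup>2) \<le> 1"
    proof -
      have "\<alpha>\<^sup>2 * (1 - a\<^sup>2) = \<alpha>\<^sup>2 * (1 - a) * (1 + a)" by (simp add: power2_eq_square algebra_simps)
      also have "\<dots> \<le> q * (1 - z1) * (1 + a)" using key a by (intro mult_right_mono) auto
      also have "\<dots> = 1 - z1\<^sup>2"
        by (simp add: z1_def q_def power2_eq_square algebra_simps)
      finally show ?thesis by simp
    qed
    then have "norm z ^ 2 \<le> 1" using dist[of 0] by simp
    then show ?thesis by (intro that[of 0]) (auto simp: power_le_one_iff abs_square_le_1)
  next
    case False
    \<comment> \<open>This weight minimises the quadratic function
      \<open>\<lambda>l. (z1 - l * t)\<^sup>2 - (1 - l)\<^sup>2\<close>.\<close>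
    define l where "l = (t * z1 - 1) / (t\<^sup>2 - 1)"
    have T: "t\<^sup>2 - 1 > 0" using t by (simp add: power_strict_mono)
    have z1: "z1 \<le> 1 + 2 * s" using mult_left_le[OF a(2) less_imp_le[OF q]] unfolding z1_def q_def by linarith
    have "t * z1 < t * t" using z1 s t by (intro mult_strict_left_mono) auto
    have l: "0 \<le> l" "l < 1"
      using False T \<open>t * z1 < t * t\<close> by (auto simp: l_def divide_simps power2_eq_square)
    have "(t\<^sup>2 - 1) * \<alpha>\<^sup>2 * (1 - a\<^sup>2) \<le> (t - z1)\<^sup>2"
    proof -
      have E: "(t\<^sup>2 - 1) * \<alpha>\<^sup>2 = (t + 1) * (t - 1 - 2 * s)"
        unfolding \<alpha>t[symmetric] by (simp add: power2_eq_square algebra_simps)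
      have "(t - z1)\<^sup>2 - (t\<^sup>2 - 1) * \<alpha>\<^sup>2 * (1 - a\<^sup>2) = ((t - s) * a - q)\<^sup>2"
        unfolding E by (simp add: z1_def q_def power2_eq_square algebra_simps)
      then show ?thesis by (smt (verit) zero_le_power2)
    qed
    moreover have "(z1 - l * t)\<^sup>2 - (1 - l)\<^sup>2 = - (t - z1)\<^sup>2 / (t\<^sup>2 - 1)"
    proof -
      have m: "l * (t\<^sup>2 - 1) = t * z1 - 1" using T by (simp add: l_def)
      have "((z1 - l * t)\<^sup>2 - (1 - l)\<^sup>2) * (t\<^sup>2 - 1) = - (t - z1)\<^sup>2"
        using m by algebra
      then show ?thesis using T by (simp add: field_simps)
    qed
    moreover from calculation(1) have "\<alpha>\<^sup>2 * (1 - a\<^sup>2) \<le> (t - z1)\<^sup>2 / (t\<^sup>2 - 1)"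
      using T by (simp add: pos_le_divide_eq mult.commute mult.left_commute)
    ultimately have "(z1 - l * t)\<^sup>2 + \<alpha>\<^sup>2 * (1 - a\<^sup>2) \<le> (1 - l)\<^sup>2"
      by simp
    then have "norm (z - (l * t) *\<^sub>R e) ^ 2 \<le> (1 - l)\<^sup>2" using dist[of l] by linarith
    then have "norm (z - (l * t) *\<^sub>R e) \<le> 1 - l"
      by (rule power2_le_imp_le) (use l in simp)
    then show ?thesis by (rule that[OF l])
  qed
qed

text \<open>The product \<open>(1 + s) * \<alpha> ^ (d - 1)\<close> is the volume of the ellipsoid above relative to
  the unit ball of dimension \<open>d\<close>. The logarithm of its square has derivative
  \<open>2 - 2 (d - 1) / (t - 1)\<close> at \<open>s = 0\<close>, which is positive exactly for
  \<open>t > d\<close>; this is where the dimension enters as the ratio of the two balls.\<close>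

lemma volume_gain:
  fixes t :: real and d :: nat
  assumes "1 \<le> d" "d < t"
  obtains s \<alpha> where "0 < s" "2 * s < t - 1" "0 < \<alpha>" "\<alpha>\<^sup>2 = 1 - 2 * s / (t - 1)"
    "1 < (1 + s) * \<alpha> ^ (d - 1)"
proof -
  define \<rho> where "\<rho> = real (d - 1) / (t - 1)"
  have t: "t > 1" using assms by linarith
  have \<rho>: "0 \<le> \<rho>" "\<rho> < 1" using assms t by (auto simp: \<rho>_def of_nat_diff field_simps)
  define s where "s = min ((t - 1) / 4) ((1 - \<rho>) / 4)"
  have s: "0 < s" using t \<rho> by (simp add: s_def)
  have s_le: "s \<le> (t - 1) / 4" "s \<le> (1 - \<rho>) / 4"
    unfolding s_def by (rule min.cobounded1, rule min.cobounded2)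
  define h where "h = 2 * s / (t - 1)"
  have h: "0 < h" "h \<le> 1 / 2" using s s_le t by (auto simp: h_def field_simps)
  define \<alpha> where "\<alpha> = sqrt (1 - h)"
  have \<alpha>: "0 < \<alpha>" "\<alpha>\<^sup>2 = 1 - h" using h by (auto simp: \<alpha>_def)
  have "1 + real (d - 1) * (- h) \<le> (1 + (- h)) ^ (d - 1)"
    using h by (intro Bernoulli_inequality) auto
  moreover have "real (d - 1) * h = 2 * s * \<rho>" by (simp add: h_def \<rho>_def)
  ultimately have B: "1 - 2 * s * \<rho> \<le> (\<alpha> ^ (d - 1))\<^sup>2"
    using \<alpha>(2) by (simp flip: power_mult add: mult.commute power_mult)
  have "s * \<rho> \<le> (1 - \<rho>) / 4 * 1" using s s_le \<rho> by (intro mult_mono) auto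
  then have "0 < 2 * s * (1 - \<rho> - 2 * (s * \<rho>))" using s(1) \<rho> by simp
  then have "1 < (1 + 2 * s) * (1 - 2 * s * \<rho>)" by (simp add: algebra_simps)
  moreover have "0 \<le> 1 - 2 * s * \<rho>" using \<open>s * \<rho> \<le> _\<close> \<rho> by simp
  then have "(1 + 2 * s) * (1 - 2 * s * \<rho>) \<le> (1 + s)\<^sup>2 * (\<alpha> ^ (d - 1))\<^sup>2"
    using B s(1) by (intro mult_mono) (auto simp: power2_eq_square algebra_simps)
  ultimately have "1\<^sup>2 < ((1 + s) * \<alpha> ^ (d - 1))\<^sup>2" by (simp add: power_mult_distrib)
  then have "1 < (1 + s) * \<alpha> ^ (d - 1)"
    using power2_less_imp_less[of 1 "(1 + s) * \<alpha> ^ (d - 1)"] s \<alpha>(1) by simp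
  then show ?thesis using that[of s \<alpha>] s s_le t \<alpha> by (auto simp: h_def)
qed

text \<open>The ellipsoid is \<open>c + A B\<close> with \<open>B\<close> the unit ball of \<open>W\<close>. Requiring
  \<open>A\<close> to be the identity on the orthogonal complement of \<open>W\<close> makes \<open>\<bar>det A\<bar>\<close>
  the volume ratio inside \<open>W\<close> whenever \<open>A\<close> maps \<open>W\<close> to itself, so that the
  volume of a flat ellipsoid is available as an ordinary determinant.\<close>

definition inscribed :: "(real ^ 'n) set \<Rightarrow> (real ^ 'n) set \<Rightarrow> real ^ 'n \<Rightarrow> real ^ 'n ^ 'n \<Rightarrow> bool" where
  "inscribed W K c A \<longleftrightarrow>
     (\<forall>x. (\<forall>z\<in>W. orthogonal x z) \<longrightarrow> A *v x = x) \<and>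
     (\<forall>x\<in>W. norm x \<le> 1 \<longrightarrow> c + A *v x \<in> K)"

text \<open>The pairs \<open>(c, A)\<close> form a compact set on which \<open>\<bar>det A\<bar>\<close> is continuous. The
  given ball of radius \<open>r\<close> is a member of positive volume, so the maximum is not
  \<open>0\<close>.\<close>

lemma maximal_inscribed_ellipsoid_exists:
  fixes K W :: "(real ^ 'n) set"
  assumes W: "subspace W" and K: "compact K" and r: "0 < r"
    and ball: "\<And>x. x \<in> W \<Longrightarrow> norm x \<le> r \<Longrightarrow> c0 + x \<in> K"
  shows "\<exists>c A. inscribed W K c A \<and> det A \<noteq> 0 \<and>
    (\<forall>c' A'. inscribed W K c' A' \<longrightarrow> \<bar>det A'\<bar> \<le> \<bar>det A\<bar>)"
proof -
  define E where "E = {(c, A). inscribed W K c A}"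
  note E_def = E_def[unfolded inscribed_def]
  have "closed E"
  proof -
    have "E = {p. \<forall>x. (\<forall>z\<in>W. orthogonal x z) \<longrightarrow> snd p *v x = x} \<inter>
              {p. \<forall>x. x \<in> W \<and> norm x \<le> 1 \<longrightarrow> fst p + snd p *v x \<in> K}"
      by (auto simp: E_def)
    moreover have cont: "continuous_on UNIV (\<lambda>p::(real^'n) \<times> (real^'n^'n). snd p *v x)" for x
      unfolding matrix_vector_mult_def
      by (intro continuous_on_vec_lambda continuous_intros)
    have "closed {p::(real^'n) \<times> (real^'n^'n). \<forall>x. (\<forall>z\<in>W. orthogonal x z) \<longrightarrow> snd p *v x = x}"
      by (intro closed_Collect_all closed_Collect_imp closed_Collect_eq cont continuous_intros) simp
    moreover have "closed {p::(real^'n) \<times> (real^'n^'n). \<forall>x. x \<in> W \<and> norm x \<le> 1 \<longrightarrow> fst p + snd p *v x \<in> K}"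
    proof (intro closed_Collect_all closed_Collect_imp)
      fix x
      have "closed ((\<lambda>p::(real^'n) \<times> (real^'n^'n). fst p + snd p *v x) -` K)"
        using K cont by (intro continuous_closed_vimage compact_imp_closed)
          (auto simp: continuous_on_eq_continuous_at intro!: continuous_intros)
      then show "closed {p::(real^'n) \<times> (real^'n^'n). fst p + snd p *v x \<in> K}" by (simp add: vimage_def)
    qed simp
    ultimately show ?thesis by (simp add: closed_Int)
  qed
  moreover have "bounded E"
  proof -
    obtain R where R: "\<And>x. x \<in> K \<Longrightarrow> norm x \<le> R"
      using compact_imp_bounded[OF K] unfolding bounded_iff by blast
    \<comment> \<open>A coordinate vector splits into a part in \<open>W\<close>, whose image is a difference of two
      points of \<open>K\<close>, and an orthogonal part, which \<open>A\<close> fixes.\<close>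
    have AR: "norm (A *v axis j 1) \<le> 2 * R + 1" and cR: "norm c \<le> R" if cA: "(c, A) \<in> E" for c A j
    proof -
      obtain p q where pq: "p \<in> W" "\<forall>z\<in>W. orthogonal q z" "axis j 1 = p + q"
        using orthogonal_subspace_decomp_exists[of W "axis j 1"] W by (metis span_eq_iff)
      have "(norm p)\<^sup>2 + (norm q)\<^sup>2 = 1"
        using pq(1,2) norm_add_Pythagorean[of p q] norm_axis_1[of j]
        by (simp add: pq(3) orthogonal_commute)
      then have "(norm p)\<^sup>2 \<le> 1\<^sup>2" "(norm q)\<^sup>2 \<le> 1\<^sup>2"
        using zero_le_power2[of "norm p"] zero_le_power2[of "norm q"] unfolding one_power2 by linarith+
      then have n1: "norm p \<le> 1" "norm q \<le> 1"
        by (auto intro: power2_le_imp_le)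
      have mem: "c + A *v x \<in> K" if "x \<in> W" "norm x \<le> 1" for x using cA that by (auto simp: E_def)
      have c: "c \<in> K" using mem[of 0] W by (simp add: subspace_0)
      then show "norm c \<le> R" by (rule R)
      have "norm ((c + A *v p) - c) \<le> R + R"
        by (intro norm_triangle_le_diff add_mono R mem pq n1 c)
      moreover have "A *v q = q" using cA pq(2) by (auto simp: E_def)
      ultimately show "norm (A *v axis j 1) \<le> 2 * R + 1"
        using norm_triangle_ineq[of "A *v p" q] n1 by (simp add: pq(3) matrix_vector_right_distrib)
    qed
    have "norm (c, A) \<le> R + (\<Sum>i\<in>(UNIV::'n set). \<Sum>j\<in>(UNIV::'n set). 2 * R + 1)" if cA: "(c, A) \<in> E" for c A
    proof -
      have entry: "\<bar>A $ i $ j\<bar> \<le> 2 * R + 1" for i j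
      proof -
        have "A $ i $ j = (A *v axis j 1) $ i" by (simp add: matrix_vector_mult_basis column_def)
        then show ?thesis using AR[OF cA, of j] component_le_norm_cart order_trans by metis
      qed
      have row: "norm (A $ i) \<le> (\<Sum>j\<in>(UNIV::'n set). 2 * R + 1)" for i
        by (rule order_trans[OF norm_le_l1_cart]) (intro sum_mono entry)
      have "norm A \<le> (\<Sum>i\<in>UNIV. norm (A $ i))"
        by (simp add: norm_vec_def L2_set_le_sum)
      also have "\<dots> \<le> (\<Sum>i\<in>(UNIV::'n set). \<Sum>j\<in>(UNIV::'n set). 2 * R + 1)"
        by (intro sum_mono row)
      finally have "norm A \<le> (\<Sum>i\<in>(UNIV::'n set). \<Sum>j\<in>(UNIV::'n set). 2 * R + 1)" .
      then show ?thesis using cR[OF cA] norm_Pair_le[of c A] by linarith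
    qed
    then show ?thesis
      unfolding bounded_iff by (intro exI[of _ "R + (\<Sum>i\<in>(UNIV::'n set). \<Sum>j\<in>(UNIV::'n set). 2 * R + 1)"]) auto
  qed
  ultimately have "compact E" by (simp add: compact_eq_bounded_closed)
  obtain S where S: "\<And>x. x \<in> W \<Longrightarrow> S *v x = r *\<^sub>R x"
    "\<And>x. (\<forall>z\<in>W. orthogonal x z) \<Longrightarrow> S *v x = x" "det S = r ^ dim W"
    using subspace_dilation_exists[OF W] by metis
  have SE: "(c0, S) \<in> E"
    using S ball r W by (auto simp: E_def subspace_scale)
  have "continuous_on E (\<lambda>p. \<bar>det (snd p)\<bar>)"
    unfolding det_def by (intro continuous_intros)
  with \<open>compact E\<close> SE obtain p where p: "p \<in> E" "\<And>q. q \<in> E \<Longrightarrow> \<bar>det (snd q)\<bar> \<le> \<bar>det (snd p)\<bar>"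
    using continuous_attains_sup[of E "\<lambda>p. \<bar>det (snd p)\<bar>"] by blast
  have inE: "inscribed W K c A \<longleftrightarrow> (c, A) \<in> E" for c A by (simp add: E_def inscribed_def)
  show ?thesis
  proof (intro exI conjI allI impI)
    show "inscribed W K (fst p) (snd p)" using p(1) by (simp add: inE)
    have "r ^ dim W > 0" using r by simp
    then show "det (snd p) \<noteq> 0" using p(2)[OF SE] S(3) by auto
    show "\<bar>det A'\<bar> \<le> \<bar>det (snd p)\<bar>" if "inscribed W K c' A'" for c' A'
      using p(2)[of "(c', A')"] that by (simp add: inE)
  qed
qed

text \<open>\<open>W\<close> is the direction space of the affine hull of \<open>K\<close>. In the coordinates of a
  largest inscribed ellipsoid, a point of \<open>K\<close> at distance more than \<open>dim W\<close> from the
  centre would allow a larger one.\<close>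

theorem John_ellipsoid:
  fixes K :: "(real ^ 'n) set"
  assumes K: "compact K" "convex K" "K \<noteq> {}"
  shows "\<exists>c (A :: real ^ 'n ^ 'n) W. subspace W \<and> int (dim W) = aff_dim K \<and>
    (\<forall>x\<in>W. norm x \<le> 1 \<longrightarrow> c + A *v x \<in> K) \<and>
    (\<forall>y\<in>K. \<exists>x\<in>W. norm x \<le> dim W \<and> y = c + A *v x)"
proof -
  obtain c0 where "c0 \<in> rel_interior K" using K rel_interior_eq_empty by blast
  then obtain r where r: "0 < r" "cball c0 r \<inter> affine hull K \<subseteq> K" and c0: "c0 \<in> K"
    by (auto simp: mem_rel_interior_cball)
  define W where "W = span ((\<lambda>x. - c0 + x) ` K)"
  have hull: "affine hull K = (\<lambda>x. c0 + x) ` W"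
    unfolding W_def by (rule affine_hull_span_gen) (simp add: c0 hull_inc)
  have W: "subspace W" and dimW: "int (dim W) = aff_dim K"
    using aff_dim_eq_dim[of c0 K] c0 by (simp_all add: W_def hull_inc)
  have diff: "y - x \<in> W" if "x \<in> K" "y \<in> K" for x y
  proof -
    have "- c0 + x \<in> W" "- c0 + y \<in> W" using that by (auto simp: W_def intro: span_base)
    then have "(- c0 + y) - (- c0 + x) \<in> W" by (intro subspace_diff W)
    then show ?thesis by simp
  qed
  have ball: "c0 + x \<in> K" if "x \<in> W" "norm x \<le> r" for x
    using r(2) that by (auto simp: hull dist_norm)
  obtain c A where ins: "inscribed W K c A" and A: "det A \<noteq> 0"
    and max: "\<And>c' A'. inscribed W K c' A' \<Longrightarrow> \<bar>det A'\<bar> \<le> \<bar>det A\<bar>"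
    using maximal_inscribed_ellipsoid_exists[OF W K(1) r(1) ball] by blast
  have cA: "(\<forall>z\<in>W. orthogonal x z) \<Longrightarrow> A *v x = x"
      "x \<in> W \<Longrightarrow> norm x \<le> 1 \<Longrightarrow> c + A *v x \<in> K" for x
    using ins by (auto simp: inscribed_def)
  have c: "c \<in> K" using cA(2)[of 0] W by (simp add: subspace_0)
  have inj: "inj ((*v) A)" using A by (simp add: invertible_det_nz inj_matrix_vector_mult)
  have "A *v x \<in> W" if "x \<in> W" for x
  proof (cases "x = 0")
    case False
    have "(c + A *v (x /\<^sub>R norm x)) - c \<in> W"
      using that False W by (intro diff c cA(2)) (auto simp: subspace_scale)
    then have "norm x *\<^sub>R (A *v (x /\<^sub>R norm x)) \<in> W" using W by (simp add: subspace_scale)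
    then show ?thesis using False by (simp add: matrix_vector_mult_scaleR)
  qed (use W in \<open>simp add: subspace_0\<close>)
  then have "(*v) A ` W \<subseteq> W" by blast
  moreover have "dim ((*v) A ` W) = dim W"
    using inj by (intro dim_image_eq) (auto intro: inj_on_subset)
  ultimately have onto: "(*v) A ` W = W"
    using W by (intro subspace_dim_equal linear_subspace_image) auto
  have "\<exists>x\<in>W. norm x \<le> dim W \<and> y0 = c + A *v x" if "y0 \<in> K" for y0
  proof -
    obtain x where x: "x \<in> W" "A *v x = y0 - c" using diff[OF c \<open>y0 \<in> K\<close>] onto by (metis imageE)
    have "norm x \<le> dim W"
    proof (rule ccontr)
      assume "\<not> norm x \<le> dim W"
      define t where "t = norm x"
      define e where "e = x /\<^sub>R t"
      have td: "t > dim W" using \<open>\<not> norm x \<le> dim W\<close> by (simp add: t_def)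
      then have t0: "t > 0" by linarith
      have e: "norm e = 1" "e \<in> W" "x = t *\<^sub>R e"
        using t0 x(1) W by (auto simp: e_def subspace_scale) (simp add: t_def)
      have d: "dim W \<ge> 1"
      proof -
        have "W \<noteq> {0}" "e \<noteq> 0" using e by auto
        then have "dim W \<noteq> 0" using e(2) by (auto simp: dim_eq_0)
        then show ?thesis by linarith
      qed
      obtain s \<alpha> where s: "0 < s" "2 * s < t - 1" and \<alpha>: "0 < \<alpha>" "\<alpha>\<^sup>2 = 1 - 2 * s / (t - 1)"
        and gain: "1 < (1 + s) * \<alpha> ^ (dim W - 1)"
        using volume_gain[OF d td] by metis
      \<comment> \<open>The dilation by \<open>\<alpha>\<close> gives all semi-axes the length \<open>\<alpha>\<close>; stretching
        along \<open>e\<close> then turns the one in that direction into \<open>1 + s\<close>.\<close>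
      obtain S where S: "\<And>x. x \<in> W \<Longrightarrow> S *v x = \<alpha> *\<^sub>R x"
        "\<And>x. (\<forall>z\<in>W. orthogonal x z) \<Longrightarrow> S *v x = x" "det S = \<alpha> ^ dim W"
        using subspace_dilation_exists[OF W] by metis
      obtain L where L: "\<And>x. L *v x = x + (((1 + s) / \<alpha> - 1) * (e \<bullet> x)) *\<^sub>R e"
        "det L = (1 + s) / \<alpha>"
        using line_stretch_exists[OF e(1)] by metis
      define A' where "A' = A ** L ** S"
      define c' where "c' = c + s *\<^sub>R (A *v e)"
      have "\<bar>det A'\<bar> \<le> \<bar>det A\<bar>"
      proof (rule max, unfold inscribed_def, intro conjI allI impI ballI)
        fix x assume x: "\<forall>z\<in>W. orthogonal x z"
        then have "e \<bullet> x = 0" using e(2) by (simp add: orthogonal_def inner_commute)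
        then show "A' *v x = x" using x cA(1) S(2) L(1)
          by (simp add: A'_def flip: matrix_vector_mul_assoc)
      next
        fix y assume y: "y \<in> W" "norm y \<le> 1"
        define z where "z = s *\<^sub>R e + \<alpha> *\<^sub>R y + ((1 + s - \<alpha>) * (e \<bullet> y)) *\<^sub>R e"
        have z: "c' + A' *v y = c + A *v z"
        proof -
          have "((1 + s) / \<alpha> - 1) * (e \<bullet> (\<alpha> *\<^sub>R y)) = (1 + s - \<alpha>) * (e \<bullet> y)"
            using \<alpha>(1) by (simp add: field_simps)
          then have "A' *v y = A *v (\<alpha> *\<^sub>R y + ((1 + s - \<alpha>) * (e \<bullet> y)) *\<^sub>R e)"
            using S(1)[OF y(1)] L(1)[of "\<alpha> *\<^sub>R y"]
            by (simp only: A'_def flip: matrix_vector_mul_assoc)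
          then show ?thesis
            by (simp add: c'_def z_def matrix_vector_right_distrib matrix_vector_mult_scaleR)
        qed
        have t1: "t > 1" using td d by linarith
        obtain l where l: "0 \<le> l" "l < 1" "norm (z - (l * t) *\<^sub>R e) \<le> 1 - l"
          using stretched_ball_in_hull_of_ball_and_point[OF e(1) y(2) t1 _ s(2) \<alpha>(2)] s(1)
          unfolding z_def by (metis less_imp_le)
        \<comment> \<open>\<open>b\<close> is the point of the unit ball in the convex combination that gives
          \<open>z\<close>.\<close>
        define b where "b = (z - (l * t) *\<^sub>R e) /\<^sub>R (1 - l)"
        have "z \<in> W" unfolding z_def using y(1) e(2) W by (intro subspace_add subspace_scale)
        then have b: "b \<in> W" "norm b \<le> 1"
          using l e(2) W by (auto simp: b_def subspace_scale subspace_diff divide_simps)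
        have "z = l *\<^sub>R x + (1 - l) *\<^sub>R b" using l by (simp add: b_def e(3))
        then have "A *v z = l *\<^sub>R (A *v x) + (1 - l) *\<^sub>R (A *v b)"
          by (simp only: matrix_vector_right_distrib matrix_vector_mult_scaleR)
        then have "c + A *v z = l *\<^sub>R (c + A *v x) + (1 - l) *\<^sub>R (c + A *v b)"
          by (simp add: algebra_simps)
        moreover have "c + A *v x \<in> K" using x(2) \<open>y0 \<in> K\<close> by simp
        ultimately have "c + A *v z \<in> K"
          using K(2) cA(2)[OF b] l by (simp add: convexD)
        then show "c' + A' *v y \<in> K" using z by simp
      qed
      moreover have "\<bar>det A'\<bar> = \<bar>det A\<bar> * ((1 + s) * \<alpha> ^ (dim W - 1))"
      proof -
        have "\<alpha> ^ dim W = \<alpha> * \<alpha> ^ (dim W - 1)" using d power_Suc[of \<alpha> "dim W - 1"] by simp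
        then have "det A' = det A * ((1 + s) * \<alpha> ^ (dim W - 1))"
          using \<alpha>(1) by (simp add: A'_def det_mul L(2) S(3))
        then show ?thesis using \<alpha>(1) s(1) by (simp add: abs_mult)
      qed
      moreover have "\<bar>det A\<bar> * 1 < \<bar>det A\<bar> * ((1 + s) * \<alpha> ^ (dim W - 1))"
        using gain A by (intro mult_strict_left_mono) auto
      ultimately show False by simp
    qed
    then show ?thesis using x by (intro bexI[of _ x]) auto
  qed
  then show ?thesis
    using W dimW cA(2) by (intro exI[of _ c] exI[of _ A] exI[of _ W] conjI ballI impI) auto
qed

section \<open>Bang's theorem for the ball\<close>

text \<open>Let \<open>y\<close> be the signed sum. The signs are chosen to maximise
  \<open>y \<bullet> y - 2 (\<Sum> \<epsilon>\<^sub>i t\<^sub>i m\<^sub>i)\<close>. Changing the sign of index \<open>j\<close>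
  changes this value by
  \<open>4 t\<^sub>j\<^sup>2 - 4 t\<^sub>j \<epsilon>\<^sub>j (u\<^sub>j \<bullet> y - m\<^sub>j)\<close>, and the change is not
  positive at a maximum.\<close>

lemma Bang_sign_choice:
  fixes u :: "'i \<Rightarrow> 'a::real_inner"
  assumes I: "finite I" and u: "\<And>i. i \<in> I \<Longrightarrow> norm (u i) = 1" and t: "\<And>i. i \<in> I \<Longrightarrow> 0 < t i"
  shows "\<exists>\<epsilon> :: 'i \<Rightarrow> real. (\<forall>i\<in>I. \<bar>\<epsilon> i\<bar> = 1) \<and>
    (\<forall>j\<in>I. t j \<le> \<bar>u j \<bullet> (\<Sum>i\<in>I. (\<epsilon> i * t i) *\<^sub>R u i) - m j\<bar>)"
proof -
  define Y where "Y \<epsilon> = (\<Sum>i\<in>I. (\<epsilon> i * t i) *\<^sub>R u i)" for \<epsilon> :: "'i \<Rightarrow> real"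
  define F where "F \<epsilon> = Y \<epsilon> \<bullet> Y \<epsilon> - 2 * (\<Sum>i\<in>I. \<epsilon> i * t i * m i)" for \<epsilon> :: "'i \<Rightarrow> real"
  define S where "S = PiE I (\<lambda>_. {-1, 1 :: real})"
  have "finite S" "S \<noteq> {}" using I by (auto simp: S_def finite_PiE PiE_eq_empty_iff)
  then obtain \<epsilon> where \<epsilon>: "\<epsilon> \<in> S" and max: "\<And>\<delta>. \<delta> \<in> S \<Longrightarrow> F \<delta> \<le> F \<epsilon>"
    using Max_in[of "F ` S"] Max_ge[of "F ` S"] by fastforce
  have sgn: "\<epsilon> i = -1 \<or> \<epsilon> i = 1" if "i \<in> I" for i using \<epsilon> that by (auto simp: S_def PiE_iff)
  show ?thesis
  proof (intro exI[of _ \<epsilon>] conjI ballI)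
    show "\<bar>\<epsilon> i\<bar> = 1" if "i \<in> I" for i using sgn[OF that] by auto
  next
    fix j assume j: "j \<in> I"
    define \<delta> where "\<delta> = \<epsilon>(j := - \<epsilon> j)"
    have \<delta>: "\<delta> \<in> S" using \<epsilon> j by (auto simp: \<delta>_def S_def PiE_iff extensional_def)
    have Y: "Y \<delta> = Y \<epsilon> - (2 * (\<epsilon> j * t j)) *\<^sub>R u j"
      and m: "(\<Sum>i\<in>I. \<delta> i * t i * m i) = (\<Sum>i\<in>I. \<epsilon> i * t i * m i) - 2 * (\<epsilon> j * t j) * m j"
    proof -
      have same: "(\<Sum>i\<in>I - {j}. (\<delta> i * t i) *\<^sub>R u i) = (\<Sum>i\<in>I - {j}. (\<epsilon> i * t i) *\<^sub>R u i)"
        "(\<Sum>i\<in>I - {j}. \<delta> i * t i * m i) = (\<Sum>i\<in>I - {j}. \<epsilon> i * t i * m i)"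
        by (auto intro!: sum.cong simp: \<delta>_def)
      then show "Y \<delta> = Y \<epsilon> - (2 * (\<epsilon> j * t j)) *\<^sub>R u j"
        unfolding Y_def sum.remove[OF I j] by (simp add: \<delta>_def algebra_simps flip: scaleR_2)
      show "(\<Sum>i\<in>I. \<delta> i * t i * m i) = (\<Sum>i\<in>I. \<epsilon> i * t i * m i) - 2 * (\<epsilon> j * t j) * m j"
        using same unfolding sum.remove[OF I j] by (simp add: \<delta>_def)
    qed
    have sq: "\<epsilon> j * \<epsilon> j = 1" using sgn[OF j] by auto
    have uu: "u j \<bullet> u j = 1" using u[OF j] by (simp add: dot_square_norm)
    have "F \<delta> - F \<epsilon> = 4 * (t j * t j * (\<epsilon> j * \<epsilon> j)) - 4 * t j * (\<epsilon> j * (u j \<bullet> Y \<epsilon> - m j))"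
      unfolding F_def m Y
      by (simp add: inner_diff_left inner_diff_right uu inner_commute[of "Y \<epsilon>" "u j"] algebra_simps)
    then have "4 * t j * t j \<le> 4 * t j * (\<epsilon> j * (u j \<bullet> Y \<epsilon> - m j))"
      using max[OF \<delta>] by (simp add: sq)
    then have "t j \<le> \<epsilon> j * (u j \<bullet> Y \<epsilon> - m j)" using t[OF j] by simp
    then show "t j \<le> \<bar>u j \<bullet> (\<Sum>i\<in>I. (\<epsilon> i * t i) *\<^sub>R u i) - m j\<bar>"
      unfolding Y_def[symmetric] using sgn[OF j] by auto
  qed
qed

text \<open>If the total width were less than \<open>2\<close>, the planks could be thickened to half-widths
  \<open>t\<^sub>i\<close> with sum \<open>1\<close>. A signed sum of the \<open>t\<^sub>i u\<^sub>i\<close> then lies in the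
  unit ball, and for suitable signs it is at distance at least \<open>t\<^sub>i\<close> from the central
  hyperplane of every plank, hence outside all the original planks.\<close>

lemma plank_theorem_unit_ball:
  fixes u :: "'i \<Rightarrow> 'a::real_inner"
  assumes I: "finite I" and W: "subspace W"
    and u: "\<And>i. i \<in> I \<Longrightarrow> norm (u i) = 1" "\<And>i. i \<in> I \<Longrightarrow> u i \<in> W"
    and ab: "\<And>i. i \<in> I \<Longrightarrow> a i \<le> b i"
    and cover: "\<And>x. x \<in> W \<Longrightarrow> norm x \<le> 1 \<Longrightarrow> \<exists>i\<in>I. a i \<le> u i \<bullet> x \<and> u i \<bullet> x \<le> b i"
  shows "2 \<le> (\<Sum>i\<in>I. b i - a i)"
proof (rule ccontr)
  assume less: "\<not> 2 \<le> (\<Sum>i\<in>I. b i - a i)"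
  have "I \<noteq> {}" using cover[of 0] W by (auto simp: subspace_0)
  then have card: "card I > 0" using I by (simp add: card_gt_0_iff)
  \<comment> \<open>The missing width is shared out evenly.\<close>
  define h where "h = (2 - (\<Sum>i\<in>I. b i - a i)) / (2 * card I)"
  have h: "h > 0" using less card by (simp add: h_def)
  define t where "t i = (b i - a i) / 2 + h" for i
  have t: "t i > 0" "t i > (b i - a i) / 2" if "i \<in> I" for i
    using ab[OF that] h by (auto simp: t_def add_nonneg_pos)
  have "(\<Sum>i\<in>I. t i) = (\<Sum>i\<in>I. b i - a i) / 2 + card I * h"
    by (simp add: t_def sum.distrib flip: sum_divide_distrib)
  then have sum_t: "(\<Sum>i\<in>I. t i) = 1" using card by (simp add: h_def field_simps)
  obtain \<epsilon> :: "'i \<Rightarrow> real" where \<epsilon>: "\<And>i. i \<in> I \<Longrightarrow> \<bar>\<epsilon> i\<bar> = 1"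
    "\<And>j. j \<in> I \<Longrightarrow> t j \<le> \<bar>u j \<bullet> (\<Sum>i\<in>I. (\<epsilon> i * t i) *\<^sub>R u i) - (a j + b j) / 2\<bar>"
    using Bang_sign_choice[of I u t "\<lambda>j. (a j + b j) / 2", OF I u(1) t(1)] by blast
  define x where "x = (\<Sum>i\<in>I. (\<epsilon> i * t i) *\<^sub>R u i)"
  have "x \<in> W" unfolding x_def using W u(2) by (intro subspace_sum subspace_scale)
  moreover have "norm x \<le> 1"
  proof -
    have "norm x \<le> (\<Sum>i\<in>I. norm ((\<epsilon> i * t i) *\<^sub>R u i))" unfolding x_def by (rule norm_sum)
    also have "\<dots> = (\<Sum>i\<in>I. t i)"
      using \<epsilon>(1) u(1) t(1) by (intro sum.cong) (auto simp: abs_mult less_imp_le)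
    finally show ?thesis using sum_t by simp
  qed
  ultimately obtain j where j: "j \<in> I" "a j \<le> u j \<bullet> x" "u j \<bullet> x \<le> b j" using cover by blast
  then show False using \<epsilon>(2)[OF j(1), folded x_def] t(2)[OF j(1)] by (auto simp: abs_if field_simps split: if_splits)
qed

section \<open>The affine plank inequality\<close>

text \<open>After the affine change of coordinates \<open>x \<mapsto> c + A x\<close> of \<open>John_ellipsoid\<close>, the
  plank with normal \<open>u\<^sub>i\<close> has normal \<open>p\<^sub>i\<close>, the projection to \<open>W\<close> of the
  transposed image of \<open>u\<^sub>i\<close>. The planks cover the unit ball, in which their widths are
  \<open>(b\<^sub>i - a\<^sub>i) / norm p\<^sub>i\<close>, and \<open>K\<close> lies in the ball of radius \<open>d\<close>,
  so that \<open>\<omega>\<^sub>i \<le> 2 d norm p\<^sub>i\<close>. In dimension \<open>0\<close> the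
  conclusion reads \<open>1 \<le> 0\<close>: there the width hypotheses cannot hold.\<close>

lemma plank_sum_compact:
  fixes K :: "(real ^ 'n) set"
  assumes K: "compact K" "convex K" "K \<noteq> {}" and I: "finite I"
    and ab: "\<And>i. i \<in> I \<Longrightarrow> a i \<le> b i"
    and width: "\<And>i. i \<in> I \<Longrightarrow> 0 < \<omega> i" "\<And>i. i \<in> I \<Longrightarrow> \<exists>x\<in>K. \<exists>y\<in>K. \<omega> i \<le> u i \<bullet> x - u i \<bullet> y"
    and cover: "\<And>x. x \<in> K \<Longrightarrow> \<exists>i\<in>I. a i \<le> u i \<bullet> x \<and> u i \<bullet> x \<le> b i"
  shows "1 \<le> aff_dim K * (\<Sum>i\<in>I. (b i - a i) / \<omega> i)"
proof -
  obtain c :: "real ^ 'n" and A :: "real ^ 'n ^ 'n" and W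
    where W: "subspace W" "int (dim W) = aff_dim K"
    and inner: "\<forall>x\<in>W. norm x \<le> 1 \<longrightarrow> c + A *v x \<in> K"
    and outer: "\<forall>y\<in>K. \<exists>x\<in>W. norm x \<le> dim W \<and> y = c + A *v x"
    using John_ellipsoid[OF K] by blast
  define d where "d = real (dim W)"
  have "\<exists>p\<in>W. \<forall>x\<in>W. u i \<bullet> (A *v x) = p \<bullet> x" for i
  proof -
    obtain p q where pq: "p \<in> W" "\<forall>z\<in>W. orthogonal q z" "transpose A *v u i = p + q"
      using orthogonal_subspace_decomp_exists[of W "transpose A *v u i"] W(1) by (metis span_eq_iff)
    have "u i \<bullet> (A *v x) = p \<bullet> x" if "x \<in> W" for x
    proof -
      have "u i \<bullet> (A *v x) = (transpose A *v u i) \<bullet> x" by (simp add: dot_lmul_matrix)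
      then show ?thesis using pq that by (simp add: inner_add_left orthogonal_def)
    qed
    then show ?thesis using pq(1) by blast
  qed
  then obtain p where p: "\<And>i. p i \<in> W" "\<And>i x. x \<in> W \<Longrightarrow> u i \<bullet> (A *v x) = p i \<bullet> x" by metis
  have wp: "\<omega> i \<le> 2 * d * norm (p i)" if i: "i \<in> I" for i
  proof -
    obtain y z where yz: "y \<in> K" "z \<in> K" "\<omega> i \<le> u i \<bullet> y - u i \<bullet> z" using width(2)[OF i] by blast
    obtain y' where y': "y' \<in> W" "norm y' \<le> d" "y = c + A *v y'" using outer yz(1) unfolding d_def by blast
    obtain z' where z': "z' \<in> W" "norm z' \<le> d" "z = c + A *v z'" using outer yz(2) unfolding d_def by blast
    have "u i \<bullet> y - u i \<bullet> z = p i \<bullet> (y' - z')"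
      using y' z' p(2) by (simp add: inner_add_right inner_diff_right)
    also have "\<dots> \<le> norm (p i) * norm (y' - z')" by (rule norm_cauchy_schwarz)
    also have "\<dots> \<le> norm (p i) * (d + d)"
      using y'(2) z'(2) by (intro mult_left_mono norm_triangle_le_diff add_mono) auto
    finally show ?thesis using yz(3) by (simp add: algebra_simps)
  qed
  have pos: "norm (p i) > 0" if "i \<in> I" for i
    using wp[OF that] width(1)[OF that] by (cases "p i = 0") auto
  \<comment> \<open>The offset caused by moving the origin to the centre of the ellipsoid.\<close>
  define \<mu> where "\<mu> i = u i \<bullet> c" for i
  have "2 \<le> (\<Sum>i\<in>I. (b i - \<mu> i) / norm (p i) - (a i - \<mu> i) / norm (p i))"
  proof (rule plank_theorem_unit_ball[OF I W(1), where u = "\<lambda>i. p i /\<^sub>R norm (p i)"])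
    fix x assume x: "x \<in> W" "norm x \<le> 1"
    obtain i where i: "i \<in> I" "a i \<le> u i \<bullet> (c + A *v x)" "u i \<bullet> (c + A *v x) \<le> b i"
      using cover inner x by blast
    then show "\<exists>i\<in>I. (a i - \<mu> i) / norm (p i) \<le> (p i /\<^sub>R norm (p i)) \<bullet> x \<and>
        (p i /\<^sub>R norm (p i)) \<bullet> x \<le> (b i - \<mu> i) / norm (p i)"
      using pos[OF i(1)] p(2)[OF x(1)]
      by (intro bexI[of _ i]) (auto simp: inner_add_right \<mu>_def divide_simps)
  qed (use pos p(1) W(1) ab in \<open>auto simp: subspace_scale divide_right_mono\<close>)
  also have "\<dots> \<le> (\<Sum>i\<in>I. 2 * d * ((b i - a i) / \<omega> i))"
  proof (rule sum_mono)
    fix i assume i: "i \<in> I"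
    have "(b i - \<mu> i) / norm (p i) - (a i - \<mu> i) / norm (p i) = (b i - a i) / norm (p i)"
      by (simp add: diff_divide_distrib)
    also have "\<dots> \<le> 2 * d * ((b i - a i) / \<omega> i)"
    proof -
      have "(b i - a i) * \<omega> i \<le> (b i - a i) * (2 * d * norm (p i))"
        using wp[OF i] ab[OF i] by (intro mult_left_mono) auto
      then show ?thesis using pos[OF i] width(1)[OF i] by (simp add: field_simps)
    qed
    finally show "(b i - \<mu> i) / norm (p i) - (a i - \<mu> i) / norm (p i) \<le> 2 * d * ((b i - a i) / \<omega> i)" .
  qed
  also have "\<dots> = 2 * (d * (\<Sum>i\<in>I. (b i - a i) / \<omega> i))"
    by (simp add: sum_distrib_left mult.assoc)
  finally have "1 \<le> d * (\<Sum>i\<in>I. (b i - a i) / \<omega> i)" by simp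
  moreover have "real_of_int (aff_dim K) = d" unfolding d_def W(2)[symmetric] by simp
  ultimately show ?thesis by simp
qed

lemma linear_orth_proj:
  assumes "subspace V"
  shows "linear (orth_proj V)"
proof -
  have uniq: "orth_proj V x = y" if y: "y \<in> V" "\<And>z. z \<in> V \<Longrightarrow> orthogonal (x - y) z" for x y
  proof -
    have "orth_proj V x - y \<in> V" using y(1) orth_proj(1)[OF assms] assms by (simp add: subspace_diff)
    then have "(x - y) \<bullet> (orth_proj V x - y) = 0" "(x - orth_proj V x) \<bullet> (orth_proj V x - y) = 0"
      using y(2) orth_proj(2)[OF assms] by (auto simp: orthogonal_def)
    then have "(orth_proj V x - y) \<bullet> (orth_proj V x - y) = 0" by (simp add: inner_diff_left)
    then show ?thesis by simp
  qed
  note P = orth_proj[OF assms]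
  show ?thesis
  proof (rule linearI)
    fix x y r
    show "orth_proj V (x + y) = orth_proj V x + orth_proj V y"
    proof (rule uniq)
      fix z assume "z \<in> V"
      then show "orthogonal (x + y - (orth_proj V x + orth_proj V y)) z"
        using P(2)[of z x] P(2)[of z y] by (simp add: orthogonal_def inner_diff_left inner_add_left)
    qed (use P(1) assms in \<open>simp add: subspace_add\<close>)
    show "orth_proj V (r *\<^sub>R x) = r *\<^sub>R orth_proj V x"
    proof (rule uniq)
      fix z assume "z \<in> V"
      then show "orthogonal (r *\<^sub>R x - r *\<^sub>R orth_proj V x) z"
        using P(2)[of z x] by (simp add: orthogonal_def inner_diff_left)
    qed (use P(1) assms in \<open>simp add: subspace_scale\<close>)
  qed
qed

text \<open>A plank with normal in \<open>V\<close> contains a point if and only if it contains the projection of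
  the point to \<open>V\<close>, and widths in such a direction are kept by the projection.\<close>

lemma inner_orth_proj:
  assumes "subspace V" "u \<in> V"
  shows "u \<bullet> orth_proj V x = u \<bullet> x"
  using orth_proj(2)[OF assms, of x] by (simp add: orthogonal_def inner_diff_left inner_diff_right inner_commute)

theorem theorem2:
  fixes C :: "(real ^ 'n) set"
    and P v :: "nat \<Rightarrow> (real ^ 'n) set"
    and w :: "nat \<Rightarrow> real"
    and k :: nat
  assumes "C \<noteq> {}" and "convex C" and "bounded C"
    and "k \<ge> 1"
    and "\<And>i. i \<in> {1..k} \<Longrightarrow> plank (v i) (w i) (P i)"
    and "C \<subseteq> (\<Union>i\<in>{1..k}. P i)"
  shows "(\<Sum>i\<in>{1..k}. ratio (w i) (width_in (v i) C))
           \<ge> ratio 1 (real_of_int (aff_dim (orth_proj (span (\<Union>i\<in>{1..k}. v i)) ` C)))"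
proof -
  define I where "I = {1..k}"
  note C = assms(1-3)
  have "\<forall>i\<in>I. \<exists>u a b. norm u = 1 \<and> a \<le> b \<and> v i = span {u} \<and> w i = b - a \<and>
      P i = {x. a \<le> u \<bullet> x \<and> u \<bullet> x \<le> b}"
    using assms(5) unfolding plank_def I_def by blast
  then obtain u a b where u: "\<And>i. i \<in> I \<Longrightarrow> norm (u i) = 1" "\<And>i. i \<in> I \<Longrightarrow> v i = span {u i}"
    and ab: "\<And>i. i \<in> I \<Longrightarrow> a i \<le> b i" "\<And>i. i \<in> I \<Longrightarrow> w i = b i - a i"
    and P: "\<And>i. i \<in> I \<Longrightarrow> P i = {x. a i \<le> u i \<bullet> x \<and> u i \<bullet> x \<le> b i}"
    unfolding bchoice_iff by blast
  have fin: "finite I" by (simp add: I_def)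
  define V where "V = span (\<Union>i\<in>I. v i)"
  have V: "subspace V" by (simp add: V_def)
  have uV: "u i \<in> V" if "i \<in> I" for i
    unfolding V_def using u(2) that by (intro span_base) (auto intro: span_base)
  define Q where "Q = orth_proj V ` C"
  have inQ: "(\<bullet>) (u i) ` Q = (\<bullet>) (u i) ` C" if "i \<in> I" for i
    unfolding Q_def image_image using inner_orth_proj[OF V uV[OF that]] by simp
  define \<omega> where "\<omega> i = width_in (v i) C" for i
  have \<omega>: "\<omega> i = (SUP x\<in>Q. u i \<bullet> x) - (INF x\<in>Q. u i \<bullet> x)" if "i \<in> I" for i
    using width_in_eq[OF u(1) C(3,1)] u(2) that by (simp add: \<omega>_def inQ)
  have lin: "linear (orth_proj V)" by (rule linear_orth_proj[OF V])
  have Q: "convex Q" "bounded Q" "Q \<noteq> {}"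
    using C lin by (auto simp: Q_def convex_linear_image bounded_linear_image linear_conv_bounded_linear)
  define K where "K = closure Q"
  have K: "compact K" "convex K" "K \<noteq> {}" and QK: "Q \<subseteq> K"
    using Q by (auto simp: K_def compact_closure convex_closure closure_subset)
  have dimK: "aff_dim K = aff_dim Q"
    by (simp add: K_def)
  have "ratio 1 (real_of_int (aff_dim Q)) \<le> (\<Sum>i\<in>I. ratio (w i) (\<omega> i))"
  \<comment> \<open>A vanishing width makes the sum infinite. Otherwise all widths are positive, which forces the
    dimension to be positive too, and the sum is an ordinary real one.\<close>
  proof (cases "\<exists>i\<in>I. \<omega> i = 0")
    case True
    then have "(\<Sum>i\<in>I. ratio (w i) (\<omega> i)) = \<infinity>"
      unfolding sum_Pinfty using fin by (auto simp: ratio_def)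
    then show ?thesis by simp
  next
    case False
    have width: "0 < \<omega> i" "\<exists>x\<in>K. \<exists>y\<in>K. \<omega> i \<le> u i \<bullet> x - u i \<bullet> y" if i: "i \<in> I" for i
    proof -
      have cont: "continuous_on K (\<lambda>z. u i \<bullet> z)" by (intro continuous_intros)
      obtain x where x: "x \<in> K" "\<And>z. z \<in> K \<Longrightarrow> u i \<bullet> z \<le> u i \<bullet> x"
        using continuous_attains_sup[OF K(1,3) cont] by blast
      obtain y where y: "y \<in> K" "\<And>z. z \<in> K \<Longrightarrow> u i \<bullet> y \<le> u i \<bullet> z"
        using continuous_attains_inf[OF K(1,3) cont] by blast
      have "(SUP z\<in>Q. u i \<bullet> z) \<le> u i \<bullet> x" "u i \<bullet> y \<le> (INF z\<in>Q. u i \<bullet> z)"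
        using x(2) y(2) Q(3) QK by (auto intro!: cSUP_least cINF_greatest)
      then show "\<exists>x\<in>K. \<exists>y\<in>K. \<omega> i \<le> u i \<bullet> x - u i \<bullet> y"
        using x(1) y(1) by (intro bexI[of _ x] bexI[of _ y]) (auto simp: \<omega>[OF i])
      have "bounded ((\<bullet>) (u i) ` Q)"
        using Q(2) by (rule bounded_linear_image) (rule bounded_linear_inner_right)
      then have bdd: "bdd_above ((\<bullet>) (u i) ` Q)" "bdd_below ((\<bullet>) (u i) ` Q)"
        by (auto intro: bounded_imp_bdd_above bounded_imp_bdd_below)
      obtain z where z: "z \<in> Q" using Q(3) by blast
      have "(INF z\<in>Q. u i \<bullet> z) \<le> u i \<bullet> z" "u i \<bullet> z \<le> (SUP z\<in>Q. u i \<bullet> z)"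
        using z bdd by (auto intro: cINF_lower cSUP_upper)
      then show "0 < \<omega> i" using False i by (force simp: \<omega>[OF i])
    qed
    have cover: "\<exists>i\<in>I. a i \<le> u i \<bullet> x \<and> u i \<bullet> x \<le> b i" if "x \<in> K" for x
    proof -
      have "closed (\<Union>i\<in>I. P i)"
        using fin P by (intro closed_UN) (auto intro!: closed_Collect_conj closed_Collect_le continuous_intros)
      moreover have "Q \<subseteq> (\<Union>i\<in>I. P i)"
      proof
        fix y assume "y \<in> Q"
        then obtain x where x: "x \<in> C" "y = orth_proj V x" by (auto simp: Q_def)
        with assms(6) obtain i where i: "i \<in> I" "x \<in> P i" unfolding I_def by blast
        then have "y \<in> P i" using x(2) P[OF i(1)] by (simp add: inner_orth_proj[OF V uV])
        then show "y \<in> (\<Union>i\<in>I. P i)" using i(1) by blast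
      qed
      ultimately have "K \<subseteq> (\<Union>i\<in>I. P i)" unfolding K_def by (rule closure_minimal[rotated])
      then show ?thesis using that P by blast
    qed
    have "1 \<le> aff_dim Q * (\<Sum>i\<in>I. w i / \<omega> i)"
      using plank_sum_compact[OF K fin ab(1) width cover] ab(2) by (simp add: dimK)
    moreover from this have "aff_dim Q \<noteq> 0" by auto
    moreover have "aff_dim Q \<ge> 0"
      using Q(3) aff_dim_geq[of Q] aff_dim_empty[of Q] by linarith
    ultimately have "1 / aff_dim Q \<le> (\<Sum>i\<in>I. w i / \<omega> i)" by (simp add: field_simps)
    moreover have "(\<Sum>i\<in>I. ratio (w i) (\<omega> i)) = ereal (\<Sum>i\<in>I. w i / \<omega> i)"
      using False by (simp add: ratio_def flip: sum_ereal)
    ultimately show ?thesis using \<open>aff_dim Q \<noteq> 0\<close> by (simp add: ratio_def)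
  qed
  then show ?thesis by (simp add: Q_def V_def I_def \<omega>_def)
qed

end
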